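(* Let $\{x_t\}$ be generated by AAP($m$) with $S_t$ and $Y_t$ of full column rank for all $t\ge 0$. At global iteration $t$, let $\{x_t^\ell\}_{\ell=0}^m$ be the points generated by AAP($m$) and $\alpha_t=(\alpha_t^0,\dots,\alpha_t^m)$ the mixing coefficients. Then, for any $B_t\in\mathbb{B}_t$, $$\sum_{\ell=0}^m \alpha_t^{\ell} x_t^{\ell} = x_t - \widehat{p}_t,\qquad\text{where}\quad \widehat{p}_t = \operatorname*{arg\,min}_{p \in \mathcal{K}_{m}(B_t, f_t)} \| B_t p- f_t \|^2 .$$ Further, $x_{t+1} = \widehat{g}_t(x_t - \widehat{p}_t)$, where $\widehat{g}_t(x) := (1-\beta_t)x + \beta_t\left[ (I+B_t) (x - x_t) + g(x_t)\right]$.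
   Context: $g:\mathbb{R}^d\to\mathbb{R}^d$ is continuously differentiable and $f(x):=g(x)-x$. $\|\cdot\|$ is the Euclidean norm. AAP($m$) (Alternating Anderson-Picard method), with integer $1\le m\le d$, damping ratios $\beta_t\ge 0$ and starting point $x_0\in\mathbb{R}^d$: for $t=0,1,2,\dots$ set $x_t^0:=x_t$, $x_t^{\ell}:=g(x_t^{\ell-1})$ for $1\le\ell\le m$, $f_t^\ell:=f(x_t^\ell)$ for $0\le\ell\le m$, and $f_t:=f_t^0=f(x_t)$. Let $\alpha_t=(\alpha_t^0,\dots,\alpha_t^m)\in\mathbb{R}^{m+1}$ minimize $\|\sum_{\ell=0}^m\alpha^\ell f_t^\ell\|^2$ subject to $\sum_{\ell=0}^m\alpha^\ell=1$, and set $x_{t+1}:=(1-\beta_t)\sum_{\ell=0}^m\alpha_t^\ell x_t^\ell+\beta_t\sum_{\ell=0}^m\alpha_t^\ell g(x_t^\ell)$. $S_t:=[s_t^0,\dots,s_t^{m-1}]$ and $Y_t:=[y_t^0,\dots,y_t^{m-1}]$ in $\mathbb{R}^{d\times m}$, where $s_t^\ell:=x_t^{\ell+1}-x_t^\ell$ and $y_t^\ell:=f_t^{\ell+1}-f_t^\ell$. $\mathbb{B}_t:=\{B\in\mathbb{R}^{d\times d}: B S_t=Y_t\}$ is the set of multisecant matrices. $\mathcal{K}_n(A,b):=\mathrm{span}\{b,Ab,\dots,A^{n-1}b\}$ is the $n$-th Krylov subspace. *)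

theory Defs
  imports "HOL-Analysis.Analysis"
begin

definition C1_map :: "('a::euclidean_space \<Rightarrow> 'b::euclidean_space) \<Rightarrow> bool" where
  "C1_map g \<longleftrightarrow>
    (\<exists>g' :: 'a \<Rightarrow> 'a \<Rightarrow>\<^sub>L 'b.
       (\<forall>x. (g has_derivative blinfun_apply (g' x)) (at x)) \<and> continuous_on UNIV g')"

definition resid :: "(real^'d \<Rightarrow> real^'d) \<Rightarrow> real^'d \<Rightarrow> real^'d" where
  "resid g x = g x - x"

text \<open>In the following definitions \<open>z\<close> is the global iterate \<open>x\<^sub>t\<close>, and \<open>l\<close> is the inner index.\<close>

definition inner_pt :: "(real^'d \<Rightarrow> real^'d) \<Rightarrow> real^'d \<Rightarrow> nat \<Rightarrow> real^'d" where
  "inner_pt g z l = (g ^^ l) z"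

definition inner_res :: "(real^'d \<Rightarrow> real^'d) \<Rightarrow> real^'d \<Rightarrow> nat \<Rightarrow> real^'d" where
  "inner_res g z l = resid g (inner_pt g z l)"

text \<open>A \<open>d \<times> m\<close> matrix is represented by its columns, a function on \<open>nat\<close> of which only the
  values at \<open>l < m\<close> matter. The lemmas after \<open>multisecant\<close> compare this with the matrices
  \<open>real^'m^'d\<close>.\<close>

definition S_cols :: "(real^'d \<Rightarrow> real^'d) \<Rightarrow> real^'d \<Rightarrow> nat \<Rightarrow> real^'d" where
  "S_cols g z l = inner_pt g z (Suc l) - inner_pt g z l"

definition Y_cols :: "(real^'d \<Rightarrow> real^'d) \<Rightarrow> real^'d \<Rightarrow> nat \<Rightarrow> real^'d" where
  "Y_cols g z l = inner_res g z (Suc l) - inner_res g z l"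

definition full_column_rank :: "nat \<Rightarrow> (nat \<Rightarrow> real^'d) \<Rightarrow> bool" where
  "full_column_rank m C \<longleftrightarrow> dim (C ` {..<m}) = m"

definition multisecant :: "nat \<Rightarrow> (nat \<Rightarrow> real^'d) \<Rightarrow> (nat \<Rightarrow> real^'d) \<Rightarrow> (real^'d^'d) set" where
  "multisecant m S Y = {B. \<forall>l<m. B *v S l = Y l}"

lemma full_column_rank_iff_rank:
  fixes e :: "'m::finite \<Rightarrow> nat" and C :: "nat \<Rightarrow> real^'d"
  assumes "bij_betw e UNIV {..<m}"
  shows "full_column_rank m C \<longleftrightarrow> rank (\<chi> i j. C (e j) $ i) = m"
proof -
  have "columns (\<chi> i j. C (e j) $ i) = C ` e ` UNIV"
    by (auto simp: columns_def column_def vec_lambda_eta)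
  also have "\<dots> = C ` {..<m}"
    using assms by (simp add: bij_betw_def)
  finally show ?thesis
    by (simp add: full_column_rank_def column_rank_def)
qed

lemma multisecant_iff_matrix_eq:
  fixes e :: "'m::finite \<Rightarrow> nat" and S Y :: "nat \<Rightarrow> real^'d"
  assumes "bij_betw e UNIV {..<m}"
  shows "B \<in> multisecant m S Y \<longleftrightarrow> B ** (\<chi> i j. S (e j) $ i) = (\<chi> i j. Y (e j) $ i)"
proof -
  have "B ** (\<chi> i j. S (e j) $ i) = (\<chi> i j. Y (e j) $ i) \<longleftrightarrow> (\<forall>j. B *v S (e j) = Y (e j))"
    by (auto simp: vec_eq_iff matrix_matrix_mult_def matrix_vector_mult_def)
  also have "\<dots> \<longleftrightarrow> (\<forall>l\<in>e ` UNIV. B *v S l = Y l)"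
    by auto
  also have "e ` UNIV = {..<m}"
    using assms by (simp add: bij_betw_def)
  finally show ?thesis
    by (simp add: multisecant_def Ball_def)
qed

text \<open>\<open>A\<^sup>k b\<close> is written as a \<open>k\<close>-fold application of \<open>A\<close>, because \<open>*\<close> on type \<open>real^'d^'d\<close> is the
  componentwise product.\<close>

definition krylov :: "nat \<Rightarrow> real^'d^'d \<Rightarrow> real^'d \<Rightarrow> (real^'d) set" where
  "krylov n A b = span ((\<lambda>k. (((*v) A) ^^ k) b) ` {..<n})"

text \<open>\<open>\<alpha> t l\<close> is the \<open>l\<close>-th mixing coefficient of iteration \<open>t\<close>; only \<open>l \<le> m\<close> matters.\<close>

definition AAP :: "(real^'d \<Rightarrow> real^'d) \<Rightarrow> nat \<Rightarrow> (nat \<Rightarrow> real) \<Rightarrow> (nat \<Rightarrow> nat \<Rightarrow> real) \<Rightarrow>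
    (nat \<Rightarrow> real^'d) \<Rightarrow> bool" where
  "AAP g m \<beta> \<alpha> x \<longleftrightarrow>
    (\<forall>t. is_arg_min (\<lambda>a. (norm (\<Sum>l\<le>m. a l *\<^sub>R inner_res g (x t) l))\<^sup>2)
           (\<lambda>a. (\<Sum>l\<le>m. a l) = 1) (\<alpha> t) \<and>
         x (Suc t) = (1 - \<beta> t) *\<^sub>R (\<Sum>l\<le>m. \<alpha> t l *\<^sub>R inner_pt g (x t) l)
           + \<beta> t *\<^sub>R (\<Sum>l\<le>m. \<alpha> t l *\<^sub>R g (inner_pt g (x t) l)))"

definition g_hat :: "(real^'d \<Rightarrow> real^'d) \<Rightarrow> real \<Rightarrow> real^'d^'d \<Rightarrow> real^'d \<Rightarrow> real^'d \<Rightarrow> real^'d" where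
  "g_hat g b B z x = (1 - b) *\<^sub>R x + b *\<^sub>R ((mat 1 + B) *v (x - z) + g z)"

end

theory Submission imports Defs begin

text \<open>Since \<open>s\<^sub>l = f\<^sub>l\<close>, the multisecant equation reads \<open>B f\<^sub>l = f\<^sub>l\<^sub>+\<^sub>1 - f\<^sub>l\<close>, so \<open>f\<^sub>l = (I + B)\<^sup>l f\<^sub>0\<close>
  and the inner residuals span the Krylov space. Affine combinations \<open>\<Sum> a\<^sub>l x\<^sub>l\<close> are therefore exactly
  the points \<open>x\<^sub>t - q\<close> with \<open>q\<close> in the Krylov space, and \<open>f\<^sub>t - B q = \<Sum> a\<^sub>l f\<^sub>l\<close>: the two least squares
  problems coincide. Uniqueness holds because \<open>B\<close> maps the span of the \<open>s\<^sub>l\<close>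
  onto the \<open>m\<close>-dimensional span of the \<open>y\<^sub>l\<close>, hence is injective on it.\<close>

lemma krylov_mono: "k \<le> n \<Longrightarrow> krylov k A b \<subseteq> krylov n A b"
  unfolding krylov_def by (intro span_mono image_mono) auto

lemma matrix_vector_mult_krylov:
  assumes "v \<in> krylov n A b"
  shows "A *v v \<in> krylov (Suc n) A b"
proof -
  have "A *v v \<in> ((*v) A) ` krylov n A b"
    using assms by blast
  also have "\<dots> = span ((*v) A ` (\<lambda>k. (((*v) A) ^^ k) b) ` {..<n})"
    unfolding krylov_def by (rule linear_span_image[symmetric]) simp
  also have "\<dots> \<subseteq> krylov (Suc n) A b"
    unfolding krylov_def
  proof (rule span_mono, clarify)
    fix k assume "k < n"
    then show "A *v ((((*v) A) ^^ k) b) \<in> (\<lambda>k. (((*v) A) ^^ k) b) ` {..<Suc n}"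
      by (intro image_eqI[of _ _ "Suc k"]) auto
  qed
  finally show ?thesis .
qed

text \<open>The recurrence gives \<open>f l\<close> as (I + A)^l applied to \<open>f 0\<close>, a
  monic polynomial of degree \<open>l\<close> in \<open>A\<close>. The change of basis to the powers
  of \<open>A\<close> is thus unitriangular, and each family spans the other.\<close>

lemma span_eq_krylov:
  fixes f :: "nat \<Rightarrow> real^'d"
  assumes step: "\<And>l. Suc l < n \<Longrightarrow> f (Suc l) = f l + A *v f l"
  shows "span (f ` {..<n}) = krylov n A (f 0)"
proof
  \<comment> \<open>The bound \<open>Suc l\<close> tracks the degree: applying \<open>A\<close>
    raises the Krylov index by one, so the fixed index \<open>n\<close> would not survive the
    induction.\<close>
  have "l < n \<Longrightarrow> f l \<in> krylov (Suc l) A (f 0)" for l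
  proof (induction l)
    case 0
    then show ?case by (auto simp: krylov_def intro: span_base)
  next
    case (Suc l)
    then have f: "f l \<in> krylov (Suc l) A (f 0)" by simp
    have "f l \<in> krylov (Suc (Suc l)) A (f 0)"
      using f krylov_mono[of "Suc l" "Suc (Suc l)"] by auto
    moreover have "A *v f l \<in> krylov (Suc (Suc l)) A (f 0)"
      using f by (rule matrix_vector_mult_krylov)
    ultimately show ?case
      using step[OF Suc.prems] by (simp add: krylov_def span_add)
  qed
  then have "f ` {..<n} \<subseteq> krylov n A (f 0)"
    using krylov_mono[of "Suc _" n A "f 0"] by (fastforce simp: Suc_le_eq)
  then show "span (f ` {..<n}) \<subseteq> krylov n A (f 0)"
    unfolding krylov_def by (simp add: span_minimal)
next
  have "l < n \<Longrightarrow> (((*v) A) ^^ l) (f 0) \<in> span (f ` {..l})" for l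
  proof (induction l)
    case 0
    then show ?case by (simp add: span_base)
  next
    case (Suc l)
    have "A *v f j \<in> span (f ` {..Suc l})" if "j \<le> l" for j
    proof -
      have "A *v f j = f (Suc j) - f j"
        using step[of j] that Suc.prems by simp
      then show ?thesis
        using that by (auto intro!: span_diff intro: span_base)
    qed
    then have "span ((*v) A ` f ` {..l}) \<subseteq> span (f ` {..Suc l})"
      by (intro span_minimal) auto
    then show ?case
      using Suc by (auto simp: linear_span_image)
  qed
  moreover have "span (f ` {..l}) \<subseteq> span (f ` {..<n})" if "l < n" for l
    using that by (intro span_mono image_mono) auto
  ultimately show "krylov n A (f 0) \<subseteq> span (f ` {..<n})"
    unfolding krylov_def by (intro span_minimal) auto
qed

text \<open>Applied to the inner points, whose differences are the columns of \<open>S\<close>, this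
  describes the Krylov space by zero-sum coefficients. The harder inclusion is telescoping from the
  base point \<open>X 0\<close>.\<close>

lemma span_consecutive_diffs:
  fixes X :: "nat \<Rightarrow> 'a::real_vector"
  shows "span ((\<lambda>l. X (Suc l) - X l) ` {..<m}) = {\<Sum>l\<le>m. a l *\<^sub>R X l | a. (\<Sum>l\<le>m. a l) = 0}"
    (is "span ?D = ?C")
proof
  have "subspace ?C"
  proof (rule subspaceI)
    show "0 \<in> ?C"
      by (rule CollectI, rule exI[of _ "\<lambda>_. 0"]) simp
  next
    fix u v assume "u \<in> ?C" "v \<in> ?C"
    then obtain a b where "u = (\<Sum>l\<le>m. a l *\<^sub>R X l)" "(\<Sum>l\<le>m. a l) = 0"
      "v = (\<Sum>l\<le>m. b l *\<^sub>R X l)" "(\<Sum>l\<le>m. b l) = 0"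
      by blast
    then show "u + v \<in> ?C"
      by (intro CollectI exI[of _ "\<lambda>l. a l + b l"]) (simp add: sum.distrib scaleR_add_left)
  next
    fix c u assume "u \<in> ?C"
    then obtain a where "u = (\<Sum>l\<le>m. a l *\<^sub>R X l)" "(\<Sum>l\<le>m. a l) = 0"
      by blast
    then show "c *\<^sub>R u \<in> ?C"
      by (intro CollectI exI[of _ "\<lambda>l. c * a l"])
        (simp add: scaleR_sum_right flip: sum_distrib_left)
  qed
  \<comment> \<open>The witness is the difference of the unit coefficient vectors at
    \<open>Suc l\<close> and \<open>l\<close>.\<close>
  moreover have "X (Suc l) - X l \<in> ?C" if "l < m" for l
    using that
    by (intro CollectI exI[of _ "\<lambda>k. of_bool (k = Suc l) - of_bool (k = l)"])
      (simp add: scaleR_diff_left sum_subtractf of_bool_def if_distrib[of "\<lambda>c. c *\<^sub>R _"] cong: if_cong)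
  ultimately show "span ?D \<subseteq> ?C"
    by (intro span_minimal) auto
next
  have diff: "X l - X 0 \<in> span ?D" if "l \<le> m" for l
  proof -
    have "X l - X 0 = (\<Sum>k<l. X (Suc k) - X k)"
      by (simp add: sum_lessThan_telescope)
    then show ?thesis
      using that by (auto intro!: span_sum intro: span_base)
  qed
  show "?C \<subseteq> span ?D"
  proof clarify
    fix a :: "nat \<Rightarrow> real" assume "(\<Sum>l\<le>m. a l) = 0"
    then have "(\<Sum>l\<le>m. a l *\<^sub>R X l) = (\<Sum>l\<le>m. a l *\<^sub>R (X l - X 0))"
      by (simp add: scaleR_diff_right sum_subtractf flip: scaleR_sum_left)
    also have "\<dots> \<in> span ?D"
      by (intro span_sum span_scale diff) simp
    finally show "(\<Sum>l\<le>m. a l *\<^sub>R X l) \<in> span ?D" .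
  qed
qed

text \<open>Weights of sum 1 let the base points be subtracted termwise; each
  \<open>X l - X 0\<close> then telescopes into steps on which \<open>T\<close> is known.\<close>

lemma linear_affine_combination:
  fixes X :: "nat \<Rightarrow> 'a::real_vector" and F :: "nat \<Rightarrow> 'b::real_vector"
  assumes lin: "linear T"
    and step: "\<And>l. l < m \<Longrightarrow> T (X (Suc l) - X l) = F (Suc l) - F l"
    and a: "(\<Sum>l\<le>m. a l) = 1"
  shows "T ((\<Sum>l\<le>m. a l *\<^sub>R X l) - X 0) = (\<Sum>l\<le>m. a l *\<^sub>R F l) - F 0"
proof -
  have diff: "T (X l - X 0) = F l - F 0" if "l \<le> m" for l
  proof -
    have "T (X l - X 0) = T (\<Sum>k<l. X (Suc k) - X k)"
      by (simp add: sum_lessThan_telescope)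
    also have "\<dots> = (\<Sum>k<l. F (Suc k) - F k)"
      using that step by (simp add: linear_sum[OF lin])
    finally show ?thesis
      by (simp add: sum_lessThan_telescope)
  qed
  have shift: "(\<Sum>l\<le>m. a l *\<^sub>R Z l) - Z 0 = (\<Sum>l\<le>m. a l *\<^sub>R (Z l - Z 0))"
    for Z :: "nat \<Rightarrow> 'c::real_vector"
    using a by (simp add: scaleR_diff_right sum_subtractf flip: scaleR_sum_left)
  have "T (\<Sum>l\<le>m. a l *\<^sub>R (X l - X 0)) = (\<Sum>l\<le>m. a l *\<^sub>R (F l - F 0))"
    by (simp add: linear_sum[OF lin] linear_scale[OF lin] diff)
  then show ?thesis
    by (simp add: shift)
qed

text \<open>The midpoint \<open>r\<close> of two minimizers is feasible, so the parallelogram law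
  forces equal images under \<open>T\<close>; injectivity on \<open>V\<close> does the rest.\<close>

lemma is_arg_min_norm_unique:
  fixes T :: "'a::real_vector \<Rightarrow> 'b::real_inner"
  assumes lin: "linear T" and V: "subspace V" and inj: "inj_on T V"
    and p: "is_arg_min (\<lambda>q. (norm (T q - b))\<^sup>2) (\<lambda>q. q \<in> V) p"
    and q: "is_arg_min (\<lambda>q. (norm (T q - b))\<^sup>2) (\<lambda>q. q \<in> V) q"
  shows "p = q"
proof -
  let ?u = "T p - b" and ?v = "T q - b"
  define r where "r = (1/2) *\<^sub>R (p + q)"
  have pV: "p \<in> V" and qV: "q \<in> V"
    using p q by (auto simp: is_arg_min_def)
  then have rV: "r \<in> V"
    unfolding r_def using V by (simp add: subspace_add subspace_scale)
  have eq: "(norm ?u)\<^sup>2 = (norm ?v)\<^sup>2"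
    using p q pV qV by (intro order_antisym) (auto simp: is_arg_min_linorder)
  have "T r - b = (1/2) *\<^sub>R (?u + ?v)"
    using scaleR_half_double[of b]
    by (simp add: r_def linear_add[OF lin] linear_scale[OF lin] algebra_simps)
  then have "(norm (T r - b))\<^sup>2 = (norm (?u + ?v))\<^sup>2 / 4"
    by (simp add: power_divide)
  moreover have "(norm (?u + ?v))\<^sup>2 + (norm (?u - ?v))\<^sup>2 = 2 * (norm ?u)\<^sup>2 + 2 * (norm ?v)\<^sup>2"
    by (simp add: power2_norm_eq_inner inner_commute algebra_simps)
  moreover have "(norm ?u)\<^sup>2 \<le> (norm (T r - b))\<^sup>2"
    using p rV by (simp add: is_arg_min_linorder)
  ultimately have "(norm (?u - ?v))\<^sup>2 \<le> 0"
    using eq by linarith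
  then have "T p = T q" by simp
  then show ?thesis
    using inj pV qV by (auto dest: inj_onD)
qed

text \<open>The rank is the dimension of a set of columns, which would hide repetitions; the chain m
  = dim \<le> card \<le> m excludes them.\<close>

lemma full_column_rank_independent:
  assumes "full_column_rank m C"
  shows "independent (C ` {..<m})" and "card (C ` {..<m}) = m"
proof -
  have "m \<le> card (C ` {..<m})"
    using assms dim_le_card'[of "C ` {..<m}"] by (simp add: full_column_rank_def)
  moreover have "card (C ` {..<m}) \<le> m"
    using card_image_le[of "{..<m}" C] by simp
  ultimately show card: "card (C ` {..<m}) = m" by simp
  show "independent (C ` {..<m})"
    using assms card
    by (intro card_le_dim_spanning[of _ "span (C ` {..<m})"])
      (auto simp: full_column_rank_def span_superset)
qed

lemma multisecant_inj_on_span: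
  assumes B: "B \<in> multisecant m S Y" and Y: "full_column_rank m Y"
  shows "inj_on ((*v) B) (span (S ` {..<m}))"
proof -
  \<comment> \<open>Since the image has \<open>m\<close> elements and there are at most
    \<open>m\<close> generators, \<open>B\<close> cannot identify two of them.\<close>
  have img: "(*v) B ` S ` {..<m} = Y ` {..<m}"
    using B by (force simp: multisecant_def image_image)
  have "card (S ` {..<m}) \<le> m"
    using card_image_le[of "{..<m}" S] by simp
  moreover have "card (Y ` {..<m}) \<le> card (S ` {..<m})"
    unfolding img[symmetric] by (rule card_image_le) simp
  ultimately have "card ((*v) B ` S ` {..<m}) = card (S ` {..<m})"
    using full_column_rank_independent(2)[OF Y] img by simp
  then have "inj_on ((*v) B) (S ` {..<m})"
    by (intro eq_card_imp_inj_on) simp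
  moreover have "independent ((*v) B ` S ` {..<m})"
    unfolding img by (rule full_column_rank_independent(1)[OF Y])
  ultimately show ?thesis
    using linear_inj_on_span_iff_independent_image[of "(*v) B" "S ` {..<m}"] by simp
qed

lemma S_cols_eq_inner_res: "S_cols g z = inner_res g z"
  by (simp add: fun_eq_iff S_cols_def inner_res_def resid_def inner_pt_def)

theorem theorem3p1:
  fixes g :: "real^'d \<Rightarrow> real^'d" and m :: nat and \<beta> :: "nat \<Rightarrow> real"
    and \<alpha> :: "nat \<Rightarrow> nat \<Rightarrow> real" and x :: "nat \<Rightarrow> real^'d"
    and t :: nat and B :: "real^'d^'d"
  assumes "C1_map g"
    and "1 \<le> m" and "m \<le> CARD('d)"
    and "\<And>t. 0 \<le> \<beta> t"
    and "AAP g m \<beta> \<alpha> x"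
    and "\<And>t. full_column_rank m (S_cols g (x t))"
    and "\<And>t. full_column_rank m (Y_cols g (x t))"
    and "B \<in> multisecant m (S_cols g (x t)) (Y_cols g (x t))"
  shows "\<exists>p. {q. is_arg_min (\<lambda>q. (norm (B *v q - resid g (x t)))\<^sup>2)
                  (\<lambda>q. q \<in> krylov m B (resid g (x t))) q} = {p} \<and>
             (\<Sum>l\<le>m. \<alpha> t l *\<^sub>R inner_pt g (x t) l) = x t - p \<and>
             x (Suc t) = g_hat g (\<beta> t) B (x t) (x t - p)"
proof -
  let ?X = "inner_pt g (x t)" and ?F = "inner_res g (x t)" and ?f = "resid g (x t)"
  let ?K = "krylov m B ?f"
  have X0: "?X 0 = x t" and F0: "?F 0 = ?f"
    by (simp_all add: inner_res_def inner_pt_def)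
  have step: "B *v (?X (Suc l) - ?X l) = ?F (Suc l) - ?F l" if "l < m" for l
    using assms(8) that by (simp add: multisecant_def S_cols_def Y_cols_def)
  have "?F (Suc l) = ?F l + B *v ?F l" if "l < m" for l
    using step[OF that] S_cols_eq_inner_res[of g "x t"] by (simp add: S_cols_def fun_eq_iff)
  \<comment> \<open>Only the residuals of index below \<open>m\<close> are generators; index
    \<open>m\<close> enters through the least squares objective.\<close>
  then have span_F: "span (?F ` {..<m}) = ?K"
    using span_eq_krylov[of m ?F B] by (simp add: F0)
  then have K: "?K = {\<Sum>l\<le>m. a l *\<^sub>R ?X l | a. (\<Sum>l\<le>m. a l) = 0}"
    using span_consecutive_diffs[of ?X m] S_cols_eq_inner_res[of g "x t"]
    by (simp add: S_cols_def fun_eq_iff)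
  have inj: "inj_on ((*v) B) ?K"
    using multisecant_inj_on_span[OF assms(8,7)] by (simp add: S_cols_eq_inner_res span_F)
  have min: "is_arg_min (\<lambda>a. (norm (\<Sum>l\<le>m. a l *\<^sub>R ?F l))\<^sup>2) (\<lambda>a. (\<Sum>l\<le>m. a l) = 1) (\<alpha> t)"
    and x_Suc: "x (Suc t) = (1 - \<beta> t) *\<^sub>R (\<Sum>l\<le>m. \<alpha> t l *\<^sub>R ?X l)
           + \<beta> t *\<^sub>R (\<Sum>l\<le>m. \<alpha> t l *\<^sub>R g (?X l))"
    using assms(5) by (auto simp: AAP_def)
  have \<alpha>: "(\<Sum>l\<le>m. \<alpha> t l) = 1"
    using min by (simp add: is_arg_min_def)
  have point: "x t - (\<Sum>l\<le>m. a l *\<^sub>R ?X l) \<in> ?K"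
    "B *v (x t - (\<Sum>l\<le>m. a l *\<^sub>R ?X l)) = ?f - (\<Sum>l\<le>m. a l *\<^sub>R ?F l)"
    if a: "(\<Sum>l\<le>m. a l) = 1" for a
  proof -
    \<comment> \<open>As \<open>x t\<close> is \<open>?X 0\<close>, subtracting the weights from the
      unit vector at 0 turns sum 1 into sum 0. \<open>K_affine\<close> uses the same involution
      backwards.\<close>
    have "(\<Sum>l\<le>m. (of_bool (l = 0) - a l) *\<^sub>R ?X l) = x t - (\<Sum>l\<le>m. a l *\<^sub>R ?X l)"
      by (simp add: scaleR_diff_left sum_subtractf of_bool_def if_distrib[of "\<lambda>c. c *\<^sub>R _"] X0
          cong: if_cong)
    moreover have "(\<Sum>l\<le>m. of_bool (l = 0) - a l) = 0"
      using a by (simp add: sum_subtractf of_bool_def)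
    ultimately show "x t - (\<Sum>l\<le>m. a l *\<^sub>R ?X l) \<in> ?K"
      unfolding K by (intro CollectI exI[of _ "\<lambda>l. of_bool (l = 0) - a l"]) simp
    have "B *v ((\<Sum>l\<le>m. a l *\<^sub>R ?X l) - x t) = (\<Sum>l\<le>m. a l *\<^sub>R ?F l) - ?f"
      using linear_affine_combination[of "(*v) B" m ?X ?F a] step a by (simp add: X0 F0)
    then show "B *v (x t - (\<Sum>l\<le>m. a l *\<^sub>R ?X l)) = ?f - (\<Sum>l\<le>m. a l *\<^sub>R ?F l)"
      by (simp add: matrix_vector_mult_diff_distrib algebra_simps)
  qed
  have K_affine: "\<exists>a. (\<Sum>l\<le>m. a l) = 1 \<and> q = x t - (\<Sum>l\<le>m. a l *\<^sub>R ?X l)" if "q \<in> ?K" for q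
  proof -
    obtain c where "q = (\<Sum>l\<le>m. c l *\<^sub>R ?X l)" "(\<Sum>l\<le>m. c l) = 0"
      using \<open>q \<in> ?K\<close> K by auto
    then show ?thesis
      by (intro exI[of _ "\<lambda>l. of_bool (l = 0) - c l"])
        (simp add: scaleR_diff_left sum_subtractf of_bool_def if_distrib[of "\<lambda>c. c *\<^sub>R _"] X0
          cong: if_cong)
  qed
  define p where "p = x t - (\<Sum>l\<le>m. \<alpha> t l *\<^sub>R ?X l)"
  have Bp: "B *v p = ?f - (\<Sum>l\<le>m. \<alpha> t l *\<^sub>R ?F l)"
    unfolding p_def by (rule point(2)[OF \<alpha>])
  have p_min: "is_arg_min (\<lambda>q. (norm (B *v q - ?f))\<^sup>2) (\<lambda>q. q \<in> ?K) p"
    unfolding is_arg_min_linorder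
  proof (intro conjI allI impI)
    show "p \<in> ?K"
      unfolding p_def by (rule point(1)[OF \<alpha>])
    fix q assume "q \<in> ?K"
    then obtain a where a: "(\<Sum>l\<le>m. a l) = 1" and q: "q = x t - (\<Sum>l\<le>m. a l *\<^sub>R ?X l)"
      using K_affine by blast
    \<comment> \<open>By \<open>point(2)\<close>, \<open>B *v q - ?f\<close> is the negative of the
      mixed residual, so both objectives agree and minimality of \<open>\<alpha> t\<close> carries
      over.\<close>
    then show "(norm (B *v p - ?f))\<^sup>2 \<le> (norm (B *v q - ?f))\<^sup>2"
      using min unfolding q point(2)[OF a] Bp by (simp add: is_arg_min_linorder)
  qed
  have "subspace ?K"
    by (simp add: krylov_def)
  then have "q = p" if "is_arg_min (\<lambda>q. (norm (B *v q - ?f))\<^sup>2) (\<lambda>q. q \<in> ?K) q" for q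
    using is_arg_min_norm_unique[of "(*v) B" ?K ?f q p] inj that p_min by simp
  then have "{q. is_arg_min (\<lambda>q. (norm (B *v q - ?f))\<^sup>2) (\<lambda>q. q \<in> ?K) q} = {p}"
    using p_min by blast
  moreover have comb: "(\<Sum>l\<le>m. \<alpha> t l *\<^sub>R ?X l) = x t - p"
    by (simp add: p_def)
  moreover have "x (Suc t) = g_hat g (\<beta> t) B (x t) (x t - p)"
  proof -
    \<comment> \<open>Writing g as identity plus residual leaves the mixed residual, which is
      \<open>?f - B *v p\<close>; the terms then regroup into the affine model at
      \<open>x t\<close>.\<close>
    have "(\<Sum>l\<le>m. \<alpha> t l *\<^sub>R g (?X l)) = (\<Sum>l\<le>m. \<alpha> t l *\<^sub>R ?X l) + (\<Sum>l\<le>m. \<alpha> t l *\<^sub>R ?F l)"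
      by (simp add: inner_res_def resid_def scaleR_diff_right flip: sum.distrib)
    also have "\<dots> = (x t - p) + (?f - B *v p)"
      by (simp add: comb Bp)
    also have "\<dots> = (mat 1 + B) *v (x t - p - x t) + g (x t)"
      by (simp add: resid_def matrix_vector_mult_add_rdistrib
          linear_neg[OF matrix_vector_mul_linear])
    finally show ?thesis
      by (simp add: x_Suc g_hat_def comb)
  qed
  ultimately show ?thesis by blast
qed

end
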